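(* Let $g:\mathbb{R}^d\to\mathbb{R}^d$ be continuous and suppose that the solution map $\phi:\mathbb{R}\times\mathbb{R}^d\to\mathbb{R}^d$ of $\dot x(t)=g(x(t))$ is well-defined and continuous. Let $Q\subset\mathbb{R}^d$ be compact and let $A_Q:=\bigcap_{t\ge0}\phi(t,Q)$. Let $(h_n)_{n=0}^\infty$ and $(\rho_n)_{n=0}^\infty$ be sequences of positive numbers with $h_n\searrow0$ and $\rho_n\searrow 0$ as $n\to\infty$, and let $(\Omega_n)_{n=0}^\infty$, $\Omega_n=\{D_i^n\subset\mathbb{R}^d: i\in I_n\}$, be a nested sequence of $\rho_n$-covers of $Q$. Suppose that the mappings $\varphi_n:I_n\to 2^{I_n}$ satisfy $$\big(\phi(-h_n,D_i^n)\cap Q\big)\subset\bigcup_{j\in\varphi_n(i)}D_j^n\quad\text{for all } i\in I_n,\ n\in\mathbb{N},$$ $$\lim_{n\to\infty}\sup_{i\in I_n}\sup_{j\in\varphi_n(i)}\operatorname{dist}(D_j^n,D_i^n)=0,$$ $$\lim_{n\to\infty}\sup_{i\in I_n}\sup_{j\in\varphi_n(i)}\sup_{x\in D^n_j}\sup_{z\in D^n_i}\|h_n^{-1}(x-z)+g(z)\|=0.$$ Then the index sets $J_n\subset I_n$ computed by the subdivision algorithm (defined in the context) satisfy, for every $n\in\mathbb{N}$, $$A_Q\subset\bigcup_{j\in J_n}D^n_j\subset A^{\varphi_n}_{\Omega_n}.$$ In particular, the sets $\bigcup_{j\in J_n}D^n_j$ converge to $A_Q$ from above, i.e. they all contain $A_Q$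 and $\lim_{n\to\infty}\operatorname{dist}\big(\bigcup_{j\in J_n}D^n_j,A_Q\big)=0$.
   Context: $\mathbb{N}=\{0,1,2,\ldots\}$, and $\|\cdot\|$ is a fixed vector norm on $\mathbb{R}^d$. The solution map being well-defined means that for each $x\in\mathbb{R}^d$ the initial value problem $\dot x(t)=g(x(t))$, $x(0)=x$, has a unique solution on $\mathbb{R}$, whose value at time $t$ is $\phi(t,x)$. For $X,Y\subset\mathbb{R}^d$, $\operatorname{diam}(X)=\sup_{x\in X}\sup_{y\in X}\|x-y\|$ and $\operatorname{dist}(X,Y)=\sup_{x\in X}\inf_{y\in Y}\|x-y\|$ (a one-sided semidistance), with the conventions $\sup\emptyset=0$ and $\inf\emptyset=+\infty$. $2^I$ is the set of all subsets of $I$, including $\emptyset$. Cover: for $\rho>0$, a collection $\Omega=\{D_i\subset\mathbb{R}^d:i\in I\}$ is a $\rho$-cover of $Q$ if $I$ is finite, $Q=\bigcup_{i\in I}D_i$, $D_i\ne\emptyset$ and $\operatorname{diam}(D_i)\le\rho$ for all $i\in I$. A sequence of $\rho_n$-covers $\Omega_n=\{D_i^n:i\in I_n\}$ of $Q$ is nested if for every $n\in\mathbb{N}$ and $i\in I_{n+1}$ there is $j\in I_n$ with $D_i^{n+1}\subset D_j^n$. Discrete attractor: for $\varphi:I\to2^I$ put $\varphi^0(i)=\{i\}$ and $\varphi^{k+1}(i)=\bigcup_{j\in\varphi^k(i)}\varphi(j)$. For a cover $\Omega=\{D_i:i\in I\}$, let $I_\Omega^\varphi=\{i\in I:\varphi^k(i)\neq\emptyset\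 \forall k\in\mathbb{N}\}$ and $A_\Omega^\varphi=\bigcup_{i\in I_\Omega^\varphi}D_i$. Subdivision algorithm: set $J_0^+:=I_0$. For $n=0,1,2,\ldots$: let $\psi_n:J_n^+\to2^{J_n^+}$, $\psi_n(i):=\varphi_n(i)\cap J_n^+$, be the restriction of $\varphi_n$ to $J_n^+$; set $J_n:=\{i\in J_n^+:\psi_n^k(i)\ne\emptyset\ \forall k\in\mathbb{N}\}$ (computed by recursively removing indices all of whose successors have been removed); then set $J_{n+1}^+:=\{i\in I_{n+1}:D_i^{n+1}\subset D_j^n\text{ for some }j\in J_n\}$. *)

theory Defs
  imports "HOL-Analysis.Analysis"
begin

text \<open>
  The norm is arbitrary, hence a parameter \<open>N\<close> and not the Euclidean norm that the
  library fixes on \<open>real ^ 'd\<close>.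
\<close>

definition vector_norm :: "('a::real_vector \<Rightarrow> real) \<Rightarrow> bool" where
  "vector_norm N \<longleftrightarrow>
     (\<forall>x. 0 \<le> N x) \<and> (\<forall>x. N x = 0 \<longleftrightarrow> x = 0) \<and>
     (\<forall>c x. N (c *\<^sub>R x) = \<bar>c\<bar> * N x) \<and> (\<forall>x y. N (x + y) \<le> N x + N y)"

text \<open>
  Suprema and infima are taken in \<open>ennreal\<close>, where the supremum of the empty set is 0
  and the infimum of the empty set is \<open>\<infinity>\<close>.
\<close>

definition diam :: "('a::real_vector \<Rightarrow> real) \<Rightarrow> 'a set \<Rightarrow> ennreal" where
  "diam N X = (SUP x\<in>X. SUP y\<in>X. ennreal (N (x - y)))"

definition semidist :: "('a::real_vector \<Rightarrow> real) \<Rightarrow> 'a set \<Rightarrow> 'a set \<Rightarrow> ennreal" where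
  "semidist N X Y = (SUP x\<in>X. INF y\<in>Y. ennreal (N (x - y)))"

definition solves_ivp :: "('a::real_normed_vector \<Rightarrow> 'a) \<Rightarrow> 'a \<Rightarrow> (real \<Rightarrow> 'a) \<Rightarrow> bool" where
  "solves_ivp g x y \<longleftrightarrow> y 0 = x \<and> (\<forall>t. (y has_vector_derivative g (y t)) (at t))"

definition solution_map ::
  "('a::real_normed_vector \<Rightarrow> 'a) \<Rightarrow> (real \<Rightarrow> 'a \<Rightarrow> 'a) \<Rightarrow> bool" where
  "solution_map g \<phi> \<longleftrightarrow>
     (\<forall>x. solves_ivp g x (\<lambda>t. \<phi> t x) \<and> (\<forall>y. solves_ivp g x y \<longrightarrow> y = (\<lambda>t. \<phi> t x)))"

definition attractor_in :: "(real \<Rightarrow> 'a \<Rightarrow> 'a) \<Rightarrow> 'a set \<Rightarrow> 'a set" where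
  "attractor_in \<phi> Q = (\<Inter>t\<in>{0..}. \<phi> t ` Q)"

definition rho_cover ::
  "('a::real_vector \<Rightarrow> real) \<Rightarrow> real \<Rightarrow> 'a set \<Rightarrow> 'i set \<Rightarrow> ('i \<Rightarrow> 'a set) \<Rightarrow> bool" where
  "rho_cover N \<rho> Q I D \<longleftrightarrow>
     0 < \<rho> \<and> finite I \<and> Q = (\<Union>i\<in>I. D i) \<and>
     (\<forall>i\<in>I. D i \<noteq> {} \<and> diam N (D i) \<le> ennreal \<rho>)"

definition nested_covers :: "(nat \<Rightarrow> 'i set) \<Rightarrow> (nat \<Rightarrow> 'i \<Rightarrow> 'a set) \<Rightarrow> bool" where
  "nested_covers I D \<longleftrightarrow> (\<forall>n. \<forall>i\<in>I (Suc n). \<exists>j\<in>I n. D (Suc n) i \<subseteq> D n j)"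

primrec iterate :: "('i \<Rightarrow> 'i set) \<Rightarrow> nat \<Rightarrow> 'i \<Rightarrow> 'i set" where
  "iterate f 0 i = {i}"
| "iterate f (Suc k) i = (\<Union>j\<in>iterate f k i. f j)"

definition viable_indices :: "'i set \<Rightarrow> ('i \<Rightarrow> 'i set) \<Rightarrow> 'i set" where
  "viable_indices I f = {i\<in>I. \<forall>k. iterate f k i \<noteq> {}}"

definition discrete_attractor :: "'i set \<Rightarrow> ('i \<Rightarrow> 'a set) \<Rightarrow> ('i \<Rightarrow> 'i set) \<Rightarrow> 'a set" where
  "discrete_attractor I D f = (\<Union>i\<in>viable_indices I f. D i)"

definition restrict_multimap :: "('i \<Rightarrow> 'i set) \<Rightarrow> 'i set \<Rightarrow> 'i \<Rightarrow> 'i set" where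
  "restrict_multimap f J i = f i \<inter> J"

text \<open>
  \<open>J_plus I D f n\<close> is the candidate index set \<open>J\<^sub>n\<^sup>+\<close> at the start of step \<open>n\<close>;
  the viable indices in it form the output \<open>J\<^sub>n\<close>, called \<open>J_alg I D f n\<close>.
\<close>

primrec J_plus ::
  "(nat \<Rightarrow> 'i set) \<Rightarrow> (nat \<Rightarrow> 'i \<Rightarrow> 'a set) \<Rightarrow> (nat \<Rightarrow> 'i \<Rightarrow> 'i set) \<Rightarrow> nat \<Rightarrow> 'i set" where
  "J_plus I D f 0 = I 0"
| "J_plus I D f (Suc n) =
     {i\<in>I (Suc n). \<exists>j\<in>viable_indices (J_plus I D f n) (restrict_multimap (f n) (J_plus I D f n)).
        D (Suc n) i \<subseteq> D n j}"

definition J_alg ::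
  "(nat \<Rightarrow> 'i set) \<Rightarrow> (nat \<Rightarrow> 'i \<Rightarrow> 'a set) \<Rightarrow> (nat \<Rightarrow> 'i \<Rightarrow> 'i set) \<Rightarrow> nat \<Rightarrow> 'i set" where
  "J_alg I D f n = viable_indices (J_plus I D f n) (restrict_multimap (f n) (J_plus I D f n))"

lemma J_plus_Suc: "J_plus I D f (Suc n) = {i\<in>I (Suc n). \<exists>j\<in>J_alg I D f n. D (Suc n) i \<subseteq> D n j}"
  by (simp add: J_alg_def)

lemma J_alg_subset: "J_alg I D f n \<subseteq> I n"
  by (cases n) (auto simp: J_alg_def viable_indices_def)

end

theory Submission
  imports Defs
begin

text \<open>
  A cell meeting the attractor has a successor meeting it, since the attractor is backward
  invariant; such cells are therefore never discarded. Conversely, a point in a surviving cell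
  starts an infinite chain of points in \<open>Q\<close> which is a perturbed Euler scheme, with step
  \<open>h\<^sub>n\<close>, for \<open>y' = - g(y)\<close>. By Tychonoff's theorem the chains, read as step functions of time,
  cluster pointwise at a limit, and the drift estimate for the scheme turns this limit directly
  into a solution staying in \<open>Q\<close>, so uniqueness of solutions places its starting point in the
  attractor. If the distance did not tend to 0, starting points bounded away from the
  attractor would contradict this.
\<close>

section \<open>Limits of perturbed Euler schemes\<close>

text \<open>
  A filter \<open>G\<close> takes the place of a convergent subsequence: over an uncountable index type the
  product need not be sequentially compact.
\<close>

lemma pointwise_cluster_function:
  fixes Y :: "'n \<Rightarrow> 't \<Rightarrow> 'a::topological_space"
  assumes Q: "compact Q" and F: "F \<noteq> bot" and YQ: "eventually (\<lambda>n. \<forall>t. Y n t \<in> Q) F"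
  obtains G y where "G \<noteq> bot" "G \<le> F" "\<And>t. y t \<in> Q" "\<And>t. ((\<lambda>n. Y n t) \<longlongrightarrow> y t) G"
proof -
  have "compactin (product_topology (\<lambda>_. euclidean) UNIV) (PiE (UNIV::'t set) (\<lambda>_. Q))"
    using Q by (simp add: compactin_PiE)
  then have "compact (PiE (UNIV::'t set) (\<lambda>_. Q))"
    by (simp add: euclidean_product_topology)
  moreover have "filtermap Y F \<noteq> bot" "eventually (\<lambda>f. f \<in> PiE UNIV (\<lambda>_. Q)) (filtermap Y F)"
    using F YQ by (auto simp: filtermap_bot_iff eventually_filtermap PiE_iff)
  ultimately obtain y where y: "y \<in> PiE UNIV (\<lambda>_. Q)" and ne: "inf (nhds y) (filtermap Y F) \<noteq> bot"
    unfolding compact_filter by blast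
  \<comment> \<open>The filter generated by \<open>F\<close> and the sets of all \<open>n\<close>
    with \<open>Y n\<close> near \<open>y\<close>. It plays the role of a subsequence along which
    \<open>Y\<close> tends to \<open>y\<close>.\<close>
  define G where "G = inf F (filtercomap Y (nhds y))"
  \<comment> \<open>If \<open>G\<close> were trivial, some neighbourhood of \<open>y\<close> would
    be missed by \<open>Y n\<close> for \<open>F\<close>-almost all \<open>n\<close>, and
    \<open>y\<close> would not be a cluster point.\<close>
  have "G \<noteq> bot"
  proof
    assume "G = bot"
    then obtain P P' where P: "eventually P F" and P': "eventually P' (filtercomap Y (nhds y))"
      and PP': "\<And>n. P n \<Longrightarrow> P' n \<Longrightarrow> False"
      unfolding G_def trivial_limit_def eventually_inf by blast
    from P' obtain R where R: "eventually R (nhds y)" and RP': "\<And>n. R (Y n) \<Longrightarrow> P' n"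
      by (auto simp: eventually_filtercomap)
    have "eventually (\<lambda>f. \<not> R f) (filtermap Y F)"
      using P unfolding eventually_filtermap by eventually_elim (use PP' RP' in blast)
    with R have "eventually (\<lambda>_. False) (inf (nhds y) (filtermap Y F))"
      unfolding eventually_inf by blast
    with ne show False by (simp add: trivial_limit_def)
  qed
  moreover have "G \<le> F" by (simp add: G_def)
  moreover have "y t \<in> Q" for t using y by (auto simp: PiE_iff)
  moreover have "((\<lambda>n. Y n t) \<longlongrightarrow> y t) G" for t
  proof -
    have lim: "(Y \<longlongrightarrow> y) G"
      by (simp add: G_def filterlim_iff_le_filtercomap)
    have "continuous_on UNIV (\<lambda>f :: 't \<Rightarrow> 'a. f t)" by simp
    from continuous_on_tendsto_compose[OF this lim] show ?thesis by simp
  qed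
  ultimately show thesis by (rule that)
qed

text \<open>Rounding \<open>t\<close> down to the grid of mesh \<open>h n\<close> loses at most
  \<open>h n\<close>. This is what turns step counts times \<open>h n\<close> into elapsed time in
  the limit.\<close>

lemma tendsto_floor_multiple:
  fixes h :: "'n \<Rightarrow> real"
  assumes "(h \<longlongrightarrow> 0) F" and "eventually (\<lambda>n. 0 < h n) F" and "0 \<le> t"
  shows "((\<lambda>n. real (nat \<lfloor>t / h n\<rfloor>) * h n) \<longlongrightarrow> t) F"
proof (rule tendsto_sandwich)
  show "eventually (\<lambda>n. t - h n \<le> real (nat \<lfloor>t / h n\<rfloor>) * h n) F"
    using assms(2)
  proof eventually_elim
    case (elim n)
    have "t / h n - 1 \<le> real (nat \<lfloor>t / h n\<rfloor>)" by linarith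
    with elim show ?case by (simp add: field_simps)
  qed
  show "eventually (\<lambda>n. real (nat \<lfloor>t / h n\<rfloor>) * h n \<le> t) F"
    using assms(2)
  proof eventually_elim
    case (elim n)
    have "real (nat \<lfloor>t / h n\<rfloor>) \<le> t / h n" using elim \<open>0 \<le> t\<close> by (simp add: of_nat_floor)
    with elim show ?case by (simp add: field_simps)
  qed
  show "((\<lambda>n. t - h n) \<longlongrightarrow> t) F"
    using tendsto_diff[OF tendsto_const assms(1), of t] by simp
qed auto

text \<open>The one-step relations telescope: each step adds the scheme error \<open>h * E\<close>
  and the error \<open>h * \<eta>\<close> of freezing \<open>g\<close> at the value
  \<open>v\<close>.\<close>

lemma perturbed_euler_drift:
  fixes p :: "nat \<Rightarrow> 'a::real_normed_vector"
  assumes step: "\<And>m. norm (p (Suc m) - p m + h *\<^sub>R g (p m)) \<le> h * E"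
    and near: "\<And>m. k \<le> m \<Longrightarrow> m < l \<Longrightarrow> norm (g (p m) - v) \<le> \<eta>"
    and "0 \<le> h" and "k \<le> l"
  shows "norm (p l - p k + (real (l - k) * h) *\<^sub>R v) \<le> real (l - k) * h * (E + \<eta>)"
  using \<open>k \<le> l\<close> near
proof (induction l rule: dec_induct)
  case base
  then show ?case by simp
next
  case (step m)
  have "p (Suc m) - p k + (real (Suc m - k) * h) *\<^sub>R v
      = (p m - p k + (real (m - k) * h) *\<^sub>R v) + (p (Suc m) - p m + h *\<^sub>R g (p m))
        - h *\<^sub>R (g (p m) - v)"
    using step(1) by (simp add: Suc_diff_le algebra_simps)
  also have "norm \<dots> \<le> real (m - k) * h * (E + \<eta>) + h * E + h * \<eta>"
  proof -
    have "norm (h *\<^sub>R (g (p m) - v)) \<le> h * \<eta>"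
      using step.prems[of m] step(1) \<open>0 \<le> h\<close> by (simp add: mult_left_mono)
    moreover have "norm (p m - p k + (real (m - k) * h) *\<^sub>R v) \<le> real (m - k) * h * (E + \<eta>)"
      by (rule step.IH) (use step.prems in auto)
    ultimately show ?thesis
      using assms(1)[of m]
        norm_triangle_ineq[of "p m - p k + (real (m - k) * h) *\<^sub>R v" "p (Suc m) - p m + h *\<^sub>R g (p m)"]
      by (intro norm_triangle_le_diff) linarith
  qed
  also have "\<dots> = real (Suc m - k) * h * (E + \<eta>)"
    using step(1) by (simp add: Suc_diff_le algebra_simps)
  finally show ?case .
qed

text \<open>The filter \<open>at x\<close> within a union is the supremum of the two filters, and a
  limit along both is a limit along their supremum. This serves to glue one-sided derivatives at
  time 0.\<close>

lemma has_vector_derivative_Un: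
  assumes "(f has_vector_derivative f') (at x within S)"
    and "(f has_vector_derivative f') (at x within T)"
  shows "(f has_vector_derivative f') (at x within (S \<union> T))"
  using assms unfolding has_vector_derivative_def has_derivative_within
  by (simp only: at_within_union) (blast intro: filterlim_sup)

text \<open>The drift estimate of the scheme survives the passage to the pointwise limit
  \<open>y\<close>. There it bounds the deviation of difference quotients of \<open>y\<close> from
  \<open>- g (y r)\<close>, and so yields differentiability and the equation at once.\<close>

lemma perturbed_euler_limit:
  fixes p :: "'n \<Rightarrow> nat \<Rightarrow> 'a::real_normed_vector"
  assumes Q: "compact Q" and g: "continuous_on Q g" and F: "F \<noteq> bot"
    and h: "(h \<longlongrightarrow> 0) F" and hpos: "eventually (\<lambda>n. 0 < h n) F"
    and E: "(E \<longlongrightarrow> 0) F"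
    and pQ: "eventually (\<lambda>n. \<forall>k. p n k \<in> Q) F"
    and step: "eventually (\<lambda>n. \<forall>k. norm (p n (Suc k) - p n k + h n *\<^sub>R g (p n k)) \<le> h n * E n) F"
  obtains G y where "G \<noteq> bot" "G \<le> F" "\<And>t. y t \<in> Q" "((\<lambda>n. p n 0) \<longlongrightarrow> y 0) G"
    "\<And>t. 0 \<le> t \<Longrightarrow> (y has_vector_derivative - g (y t)) (at t within {0..})"
proof -
  \<comment> \<open>For \<open>t \<ge> 0\<close> and positive \<open>h n\<close> this is the index
    of the last grid point not after \<open>t\<close>. For negative \<open>t\<close> the truncation
    by \<open>nat\<close> gives index 0, so the step function makes sense at all real times.\<close>
  define \<kappa> where "\<kappa> n t = nat \<lfloor>t / h n\<rfloor>" for n t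
  have "eventually (\<lambda>n. \<forall>t. p n (\<kappa> n t) \<in> Q) F"
    using pQ by eventually_elim simp
  then obtain G y where G: "G \<noteq> bot" "G \<le> F" and yQ: "\<And>t. y t \<in> Q"
    and lim: "\<And>t. ((\<lambda>n. p n (\<kappa> n t)) \<longlongrightarrow> y t) G"
    using pointwise_cluster_function[OF Q F, where Y = "\<lambda>n t. p n (\<kappa> n t)"] by metis
  have evG: "eventually P G" if "eventually P F" for P
    using that G(2) by (auto simp: le_filter_def)
  have hG: "(h \<longlongrightarrow> 0) G" and EG: "(E \<longlongrightarrow> 0) G"
    using h E G(2) by (auto intro: filterlim_mono)
  obtain M where M: "0 < M" "\<And>x. x \<in> Q \<Longrightarrow> norm (g x) \<le> M"
    using compact_imp_bounded[OF compact_continuous_image[OF g Q]] by (auto simp: bounded_pos)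
  have glim: "((\<lambda>n. g (p n (\<kappa> n t))) \<longlongrightarrow> g (y t)) G" for t
  proof (rule continuous_on_tendsto_compose[OF g lim yQ])
    show "eventually (\<lambda>n. p n (\<kappa> n t) \<in> Q) G"
      using evG[OF pQ] by eventually_elim simp
  qed
  \<comment> \<open>The time \<open>r\<close> at which \<open>g\<close> is frozen may be either end
    of the interval: \<open>r = t\<close> serves the left difference quotients at \<open>t\<close>,
    and \<open>r = s\<close> the right ones at \<open>s\<close>.\<close>
  have drift: "\<exists>\<delta>>0. \<forall>s r t. 0 \<le> s \<and> s \<le> r \<and> r \<le> t \<and> t - s < \<delta> \<longrightarrow>
      norm (y t - y s + (t - s) *\<^sub>R g (y r)) \<le> (t - s) * \<eta>" if "0 < \<eta>" for \<eta>
  proof -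
    have "uniformly_continuous_on Q g"
      using g Q by (rule compact_uniformly_continuous)
    then obtain d where d: "0 < d"
      and unif: "\<And>a b. a \<in> Q \<Longrightarrow> b \<in> Q \<Longrightarrow> norm (a - b) < d \<Longrightarrow> norm (g a - g b) < \<eta>"
      using \<open>0 < \<eta>\<close> unfolding uniformly_continuous_on_def dist_norm by metis
    \<comment> \<open>The threshold comes from the speed of the scheme: once \<open>E n < 1\<close>
      it is at most \<open>M + 1\<close>, so over a time below \<open>d / (M + 1)\<close> the scheme
      moves by less than \<open>d\<close>, the radius of uniform continuity of \<open>g\<close> for
      \<open>\<eta>\<close>.\<close>
    have "norm (y t - y s + (t - s) *\<^sub>R g (y r)) \<le> (t - s) * \<eta>"
      if srt: "0 \<le> s" "s \<le> r" "r \<le> t" and small: "t - s < d / (M + 1)" for s r t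
    proof -
      \<comment> \<open>The time that the scheme itself spends between the indices belonging to
        \<open>s\<close> and \<open>t\<close>.\<close>
      define \<tau> where "\<tau> n = real (\<kappa> n t - \<kappa> n s) * h n" for n
      have \<kappa>: "\<kappa> n s \<le> \<kappa> n r" "\<kappa> n r \<le> \<kappa> n t" if "0 < h n" for n
        using srt that by (auto simp: \<kappa>_def intro!: nat_mono floor_mono divide_right_mono)
      have "((\<lambda>n. real (\<kappa> n t) * h n - real (\<kappa> n s) * h n) \<longlongrightarrow> t - s) G"
        unfolding \<kappa>_def using srt
        by (intro tendsto_diff tendsto_floor_multiple hG evG[OF hpos]) auto
      moreover have "eventually (\<lambda>n. real (\<kappa> n t) * h n - real (\<kappa> n s) * h n = \<tau> n) G"
        using evG[OF hpos]
      proof eventually_elim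
        case (elim n)
        with \<kappa>[of n] show ?case by (simp add: \<tau>_def of_nat_diff algebra_simps)
      qed
      ultimately have \<tau>lim: "(\<tau> \<longlongrightarrow> t - s) G"
        by (rule Lim_transform_eventually)
      have small': "eventually (\<lambda>n. \<tau> n < d / (M + 1)) G"
        using \<tau>lim small by (rule order_tendstoD)
      have E1: "eventually (\<lambda>n. E n < 1) G"
        using EG by (rule order_tendstoD) simp
      have le: "eventually (\<lambda>n. norm (p n (\<kappa> n t) - p n (\<kappa> n s) + \<tau> n *\<^sub>R g (p n (\<kappa> n r)))
          \<le> \<tau> n * (E n + \<eta>)) G"
        using small' E1 evG[OF hpos] evG[OF pQ] evG[OF step]
      proof eventually_elim
        case (elim n)
        note st = elim(5)[rule_format]
        have dist: "norm (p n b - p n a) < d" if "\<kappa> n s \<le> a" "a \<le> b" "b \<le> \<kappa> n t" for a b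
        proof -
          \<comment> \<open>With \<open>v = 0\<close> and \<open>\<eta> = M\<close> the drift
            estimate becomes a bound on the speed.\<close>
          have "norm (p n b - p n a) \<le> real (b - a) * h n * (E n + M)"
            using perturbed_euler_drift[where p = "p n", OF st, where v = 0 and k = a and l = b and \<eta> = M] elim that M(2)
            by simp
          also have "\<dots> \<le> real (b - a) * h n * (M + 1)"
            using elim by (intro mult_left_mono) auto
          also have "\<dots> \<le> \<tau> n * (M + 1)"
            unfolding \<tau>_def using elim that M(1) by (intro mult_right_mono) auto
          also have "\<dots> < d" using elim M(1) by (simp add: pos_less_divide_eq)
          finally show ?thesis .
        qed
        have "norm (g (p n m) - g (p n (\<kappa> n r))) \<le> \<eta>" if "\<kappa> n s \<le> m" "m < \<kappa> n t" for m
        proof (cases "m \<le> \<kappa> n r")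
          case True
          with dist[of m "\<kappa> n r"] \<kappa>[of n] elim that show ?thesis
            by (intro less_imp_le unif) (auto simp: norm_minus_commute)
        next
          case False
          with dist[of "\<kappa> n r" m] \<kappa>[of n] elim that show ?thesis
            by (intro less_imp_le unif) auto
        qed
        moreover have "\<kappa> n s \<le> \<kappa> n t" using \<kappa>[of n] elim by auto
        ultimately show ?case
          unfolding \<tau>_def using elim by (intro perturbed_euler_drift st) auto
      qed
      have "norm (y t - y s + (t - s) *\<^sub>R g (y r)) \<le> (t - s) * (0 + \<eta>)"
        by (rule tendsto_le[OF G(1) _ _ le]) (intro tendsto_intros \<tau>lim lim glim EG)+
      then show ?thesis by simp
    qed
    with d M(1) show ?thesis by (intro exI[of _ "d / (M + 1)"]) auto
  qed
  have "(y has_vector_derivative - g (y t)) (at t within {0..})" if "0 \<le> t" for t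
    unfolding has_vector_derivative_def has_derivative_within_alt
  proof (intro conjI allI impI)
    show "bounded_linear (\<lambda>s. s *\<^sub>R - g (y t))" by (rule bounded_linear_scaleR_left)
    fix e :: real assume "0 < e"
    from drift[OF this] obtain \<delta> where \<delta>: "0 < \<delta>"
      and dr: "\<And>s r t. 0 \<le> s \<Longrightarrow> s \<le> r \<Longrightarrow> r \<le> t \<Longrightarrow> t - s < \<delta> \<Longrightarrow>
        norm (y t - y s + (t - s) *\<^sub>R g (y r)) \<le> (t - s) * e" by blast
    have "norm (y s - y t - (s - t) *\<^sub>R - g (y t)) \<le> e * norm (s - t)"
      if "0 \<le> s" "norm (s - t) < \<delta>" for s
    proof (cases "s \<le> t")
      case True
      then have "norm (y t - y s + (t - s) *\<^sub>R g (y t)) \<le> (t - s) * e"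
        using that by (intro dr) auto
      moreover have "y s - y t - (s - t) *\<^sub>R - g (y t) = - (y t - y s + (t - s) *\<^sub>R g (y t))"
        by (simp add: algebra_simps)
      ultimately show ?thesis
        using True by (metis abs_minus_commute abs_of_nonneg diff_ge_0_iff_ge mult.commute
            norm_minus_cancel real_norm_def)
    next
      case False
      with dr[of t t s] that \<open>0 \<le> t\<close> show ?thesis by (simp add: mult.commute)
    qed
    with \<delta> show "\<exists>d>0. \<forall>s\<in>{0..}. norm (s - t) < d \<longrightarrow>
        norm (y s - y t - (s - t) *\<^sub>R - g (y t)) \<le> e * norm (s - t)"
      by auto
  qed
  moreover have "((\<lambda>n. p n 0) \<longlongrightarrow> y 0) G"
    using lim[of 0] by (simp add: \<kappa>_def)
  ultimately show thesis using G yQ by (intro that[of G y])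
qed

section \<open>Equivalence of norms\<close>

text \<open>Expansion in the basis bounds \<open>N\<close> from above and makes it Lipschitz, so it
  attains a positive minimum on the unit sphere. By homogeneity the inverse of this minimum serves
  as \<open>c\<close>.\<close>

lemma vector_norm_equivalent:
  fixes N :: "'a::euclidean_space \<Rightarrow> real"
  assumes "vector_norm N"
  obtains c C where "0 < c" "0 < C" "\<And>x. norm x \<le> c * N x" "\<And>x. N x \<le> C * norm x"
proof -
  have N0: "\<And>x. 0 \<le> N x" "\<And>x. N x = 0 \<longleftrightarrow> x = 0"
    and Nscale: "\<And>a x. N (a *\<^sub>R x) = \<bar>a\<bar> * N x" and Nadd: "\<And>x y. N (x + y) \<le> N x + N y"
    using assms by (auto simp: vector_norm_def)
  define C where "C = 1 + (\<Sum>b\<in>Basis. N b)"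
  have Cpos: "0 < C" using N0(1) by (simp add: C_def add_pos_nonneg sum_nonneg)
  have up: "N x \<le> C * norm x" for x
  proof -
    have sum_le: "N (sum u B) \<le> (\<Sum>b\<in>B. N (u b))" if "finite B" for u :: "'a \<Rightarrow> 'a" and B
      using that
    proof induction
      case empty
      then show ?case using N0(2)[of 0] by simp
    next
      case (insert b B)
      then show ?case using Nadd[of "u b" "sum u B"] by simp
    qed
    have "N x = N (\<Sum>b\<in>Basis. (x \<bullet> b) *\<^sub>R b)" by (simp add: euclidean_representation)
    also have "\<dots> \<le> (\<Sum>b\<in>Basis. N ((x \<bullet> b) *\<^sub>R b))" by (rule sum_le) simp
    also have "\<dots> \<le> (\<Sum>b\<in>Basis. norm x * N b)"
      by (intro sum_mono) (simp add: Nscale Basis_le_norm N0(1) mult_right_mono)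
    also have "\<dots> \<le> C * norm x" by (simp add: C_def sum_distrib_left algebra_simps)
    finally show ?thesis .
  qed
  have "C-lipschitz_on UNIV N"
  proof (rule lipschitz_onI)
    fix x y
    have "N x \<le> N (x - y) + N y" "N y \<le> N (y - x) + N x"
      using Nadd[of "x - y" y] Nadd[of "y - x" x] by simp_all
    with up[of "x - y"] up[of "y - x"] show "dist (N x) (N y) \<le> C * dist x y"
      by (simp add: dist_norm norm_minus_commute)
  qed (use Cpos in simp)
  then have "continuous_on (sphere 0 1) N"
    using lipschitz_on_continuous_on continuous_on_subset by blast
  moreover have "sphere (0::'a) 1 \<noteq> {}" by simp
  ultimately obtain u where u: "norm u = 1" and min: "\<And>v. norm v = 1 \<Longrightarrow> N u \<le> N v"
    using continuous_attains_inf[of "sphere (0::'a) 1" N] compact_sphere by auto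
  have Nu: "0 < N u" using N0 u by (metis less_eq_real_def norm_zero zero_neq_one)
  have "norm x \<le> inverse (N u) * N x" for x
  proof (cases "x = 0")
    case False
    then have "N u \<le> N (inverse (norm x) *\<^sub>R x)" by (intro min) simp
    with False Nu show ?thesis by (simp add: Nscale field_simps)
  qed (simp add: N0)
  with Nu Cpos up that show thesis by (metis inverse_positive_iff_positive)
qed

section \<open>The flow and its attractor\<close>

lemma solution_map_deriv:
  "solution_map g \<phi> \<Longrightarrow> ((\<lambda>t. \<phi> t x) has_vector_derivative g (\<phi> t x)) (at t)"
  by (simp add: solution_map_def solves_ivp_def)

lemma solution_map_unique:
  "solution_map g \<phi> \<Longrightarrow> solves_ivp g x y \<Longrightarrow> y t = \<phi> t x"
  unfolding solution_map_def by metis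

text \<open>As functions of \<open>s\<close>, both sides solve the initial value problem started at
  \<open>\<phi> t x\<close>, and uniqueness identifies them.\<close>

lemma solution_map_add:
  assumes "solution_map g \<phi>"
  shows "\<phi> (s + t) x = \<phi> s (\<phi> t x)"
proof -
  have "((\<lambda>s. \<phi> (s + t) x) has_vector_derivative g (\<phi> (s + t) x)) (at s)" for s
  proof -
    have "((\<lambda>s. s + t) has_vector_derivative 1) (at s)"
      by (auto intro!: derivative_eq_intros)
    from vector_diff_chain_at[OF this solution_map_deriv[OF assms]] show ?thesis by (simp add: o_def)
  qed
  then have "solves_ivp g (\<phi> t x) (\<lambda>s. \<phi> (s + t) x)" by (simp add: solves_ivp_def)
  from solution_map_unique[OF assms this] show ?thesis .
qed

lemma solution_map_zero: "solution_map g \<phi> \<Longrightarrow> \<phi> 0 x = x"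
  by (simp add: solution_map_def solves_ivp_def)

text \<open>Since \<open>\<phi> (- t)\<close> inverts \<open>\<phi> t\<close>, lying in all forward
  images of \<open>Q\<close> amounts to having a backward orbit in \<open>Q\<close>. All later
  arguments use this form.\<close>

lemma mem_attractor_in_iff:
  assumes "solution_map g \<phi>"
  shows "x \<in> attractor_in \<phi> Q \<longleftrightarrow> (\<forall>t\<ge>0. \<phi> (- t) x \<in> Q)"
proof -
  have inv: "\<phi> t (\<phi> (- t) z) = z" "\<phi> (- t) (\<phi> t z) = z" for t z
    using solution_map_add[OF assms, of t "- t" z] solution_map_add[OF assms, of "- t" t z]
    by (simp_all add: solution_map_zero[OF assms])
  have "x \<in> \<phi> t ` Q \<longleftrightarrow> \<phi> (- t) x \<in> Q" for t
  proof
    assume "\<phi> (- t) x \<in> Q"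
    from imageI[OF this, of "\<phi> t"] show "x \<in> \<phi> t ` Q" by (simp only: inv)
  qed (auto simp: inv)
  then show ?thesis unfolding attractor_in_def by auto
qed

lemma attractor_in_backward:
  assumes "solution_map g \<phi>" and "x \<in> attractor_in \<phi> Q" and "0 \<le> t"
  shows "\<phi> (- t) x \<in> attractor_in \<phi> Q"
proof -
  have "\<phi> (- s) (\<phi> (- t) x) \<in> Q" if "0 \<le> s" for s
  proof -
    have "\<forall>t\<ge>0. \<phi> (- t) x \<in> Q"
      using assms(2) by (simp only: mem_attractor_in_iff[OF assms(1)])
    then have "\<phi> (- (s + t)) x \<in> Q"
      using that \<open>0 \<le> t\<close> add_nonneg_nonneg by blast
    then show ?thesis using solution_map_add[OF assms(1), of "- s" "- t" x] by simp
  qed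
  then show ?thesis by (simp add: mem_attractor_in_iff[OF assms(1)])
qed

text \<open>Uniqueness concerns solutions on the whole real line, whereas \<open>y\<close> solves
  the reversed equation on a half-line. Reversing time in \<open>y\<close> and continuing with the
  flow for positive times gives a global solution \<open>z\<close>.\<close>

lemma backward_solution_unique:
  assumes sol: "solution_map g \<phi>"
    and y: "\<And>t. 0 \<le> t \<Longrightarrow> (y has_vector_derivative - g (y t)) (at t within {0..})"
    and "0 \<le> t"
  shows "\<phi> (- t) (y 0) = y t"
proof -
  define z where "z s = (if s \<le> 0 then y (- s) else \<phi> s (y 0))" for s
  have left: "(z has_vector_derivative g (z s)) (at s within {..0})" if "s \<le> 0" for s
  proof -
    have "(uminus has_vector_derivative (-1::real)) (at s within {..0})"
      by (auto intro!: derivative_eq_intros)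
    moreover have "(y has_vector_derivative - g (y (- s))) (at (- s) within uminus ` {..0})"
      using y[of "- s"] that by simp
    ultimately have "(y \<circ> uminus has_vector_derivative (- 1) *\<^sub>R - g (y (- s))) (at s within {..0})"
      by (rule vector_diff_chain_within)
    then have "(y \<circ> uminus has_vector_derivative g (y (- s))) (at s within {..0})"
      by simp
    then have "(z has_vector_derivative g (y (- s))) (at s within {..0})"
      by (rule has_vector_derivative_transform[rotated 2]) (use that in \<open>auto simp: z_def\<close>)
    with that show ?thesis by (simp add: z_def)
  qed
  have z\<phi>: "z s = \<phi> s (y 0)" if "0 \<le> s" for s
    using that by (auto simp: z_def solution_map_zero[OF sol])
  have right: "(z has_vector_derivative g (z s)) (at s within {0..})" if "0 \<le> s" for s
  proof -
    have "((\<lambda>s. \<phi> s (y 0)) has_vector_derivative g (\<phi> s (y 0))) (at s within {0..})"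
      by (rule has_vector_derivative_at_within[OF solution_map_deriv[OF sol]])
    then have "(z has_vector_derivative g (\<phi> s (y 0))) (at s within {0..})"
      by (rule has_vector_derivative_transform[rotated 2]) (use that z\<phi> in auto)
    with that show ?thesis by (simp add: z\<phi>)
  qed
  have "(z has_vector_derivative g (z s)) (at s)" for s
  proof (cases s "0::real" rule: linorder_cases)
    case less
    with left[of s] show ?thesis by (simp add: at_within_interior[of s "{..0}"])
  next
    case greater
    with right[of s] show ?thesis by (simp add: at_within_interior[of s "{0..}"])
  next
    case equal
    have "{..0} \<union> {0..} = (UNIV::real set)" by auto
    with has_vector_derivative_Un[OF left[of s] right[of s]] equal show ?thesis by simp
  qed
  then have "solves_ivp g (y 0) z" by (simp add: solves_ivp_def z_def)
  from solution_map_unique[OF sol this, of "- t"] \<open>0 \<le> t\<close> show ?thesis by (simp add: z_def)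
qed

section \<open>Viable indices of a set-valued map\<close>

lemma iterate_Suc_left: "iterate f (Suc k) i = (\<Union>j\<in>f i. iterate f k j)"
  by (induction k) auto

lemma iterate_empty_mono: "iterate f k i = {} \<Longrightarrow> k \<le> l \<Longrightarrow> iterate f l i = {}"
  by (induction l rule: nat_induct) (auto simp: le_Suc_eq)

text \<open>The step of Koenig's lemma: if all successors died out, finiteness of \<open>f i\<close>
  would give a common time by which all are dead, and \<open>i\<close> would be dead one step
  later.\<close>

lemma viable_successor:
  assumes "finite I" and "\<And>i. i \<in> I \<Longrightarrow> f i \<subseteq> I" and i: "i \<in> viable_indices I f"
  obtains j where "j \<in> f i" "j \<in> viable_indices I f"
proof (rule ccontr)
  assume "\<not> thesis"
  have "f i \<subseteq> I" using assms(2) i by (simp add: viable_indices_def)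
  with \<open>\<not> thesis\<close> have "\<forall>j\<in>f i. \<exists>k. iterate f k j = {}"
    using that unfolding viable_indices_def by blast
  then obtain k where k: "\<And>j. j \<in> f i \<Longrightarrow> iterate f (k j) j = {}" by metis
  have fin: "finite (f i)"
    using assms(1) \<open>f i \<subseteq> I\<close> by (rule finite_subset[rotated])
  \<comment> \<open>If \<open>f i\<close> is empty, this \<open>Max\<close> is unspecified, but then
    the claim is vacuous and the union over the successors is empty.\<close>
  have "iterate f (Max (k ` f i)) j = {}" if "j \<in> f i" for j
    using k[OF that] by (rule iterate_empty_mono) (use fin that in auto)
  then have "iterate f (Suc (Max (k ` f i))) i = {}" by (simp only: iterate_Suc_left) simp
  with i show False unfolding viable_indices_def by blast
qed

lemma viable_chain:
  assumes "finite I" and "\<And>i. i \<in> I \<Longrightarrow> f i \<subseteq> I" and "i \<in> viable_indices I f"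
  obtains c :: "nat \<Rightarrow> 'i" where "c 0 = i" "\<And>k. c k \<in> I" "\<And>k. c (Suc k) \<in> f (c k)"
proof -
  \<comment> \<open>The clause for \<open>k = 0\<close> carries the prescribed starting index
    through dependent choice.\<close>
  have "\<exists>c. \<forall>k. (c k \<in> viable_indices I f \<and> (k = 0 \<longrightarrow> c k = i)) \<and> c (Suc k) \<in> f (c k)"
  proof (rule dependent_nat_choice)
    show "\<exists>x. x \<in> viable_indices I f \<and> (0 = (0::nat) \<longrightarrow> x = i)" using assms(3) by blast
    show "\<exists>y. (y \<in> viable_indices I f \<and> (Suc n = 0 \<longrightarrow> y = i)) \<and> y \<in> f x"
      if "x \<in> viable_indices I f \<and> (n = 0 \<longrightarrow> x = i)" for x n
    proof -
      from that have "x \<in> viable_indices I f" ..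
      with assms(1,2) obtain y where "y \<in> f x" "y \<in> viable_indices I f"
        by (rule viable_successor)
      then show ?thesis by auto
    qed
  qed
  then obtain c where
    c: "\<forall>k. (c k \<in> viable_indices I f \<and> (k = 0 \<longrightarrow> c k = i)) \<and> c (Suc k) \<in> f (c k)" ..
  show thesis
  proof (rule that)
    show "c 0 = i" "c k \<in> I" "c (Suc k) \<in> f (c k)" for k
      using c by (auto simp: viable_indices_def)
  qed
qed

text \<open>By induction every iterate started in \<open>S\<close> meets \<open>S\<close> again,
  hence never becomes empty.\<close>

lemma subset_viable_indices:
  assumes "S \<subseteq> I" and "\<And>i. i \<in> S \<Longrightarrow> f i \<inter> S \<noteq> {}"
  shows "S \<subseteq> viable_indices I f"
proof -
  have "iterate f k i \<inter> S \<noteq> {}" if "i \<in> S" for i k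
  proof (induction k)
    case (Suc k)
    then obtain j where "j \<in> iterate f k i" "j \<in> S" by blast
    with assms(2)[of j] show ?case by auto
  qed (use that in simp)
  with assms(1) show ?thesis by (fastforce simp: viable_indices_def)
qed

lemma viable_indices_mono:
  assumes "I \<subseteq> I'" and "\<And>i. f i \<subseteq> f' i"
  shows "viable_indices I f \<subseteq> viable_indices I' f'"
proof -
  have "iterate f k i \<subseteq> iterate f' k i" for k i
    by (induction k) (use assms(2) in fastforce)+
  with assms(1) show ?thesis unfolding viable_indices_def by fast
qed

section \<open>Index sets of the subdivision algorithm\<close>

lemma J_plus_subset: "J_plus I D f n \<subseteq> I n"
  by (cases n) auto

lemma J_alg_subset_viable: "J_alg I D f n \<subseteq> viable_indices (I n) (f n)"
  unfolding J_alg_def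
  by (rule viable_indices_mono[OF J_plus_subset]) (simp add: restrict_multimap_def)

text \<open>Induction over the levels. If all cells meeting \<open>A\<close> are candidates, each
  has a successor among them, so all of them survive. By nestedness a cell of the next level meeting
  \<open>A\<close> lies in such a survivor and becomes a candidate itself.\<close>

lemma J_alg_memI:
  assumes nest: "nested_covers I D"
    and succ: "\<And>n i. i \<in> I n \<Longrightarrow> D n i \<inter> A \<noteq> {} \<Longrightarrow> \<exists>j\<in>f n i \<inter> I n. D n j \<inter> A \<noteq> {}"
    and "i \<in> I n" "D n i \<inter> A \<noteq> {}"
  shows "i \<in> J_alg I D f n"
proof -
  have plus: "{i \<in> I n. D n i \<inter> A \<noteq> {}} \<subseteq> J_alg I D f n"
    if "{i \<in> I n. D n i \<inter> A \<noteq> {}} \<subseteq> J_plus I D f n" for n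
    unfolding J_alg_def
  proof (rule subset_viable_indices[OF that])
    fix i assume "i \<in> {i \<in> I n. D n i \<inter> A \<noteq> {}}"
    with succ[of i n] that
    show "restrict_multimap (f n) (J_plus I D f n) i \<inter> {i \<in> I n. D n i \<inter> A \<noteq> {}} \<noteq> {}"
      unfolding restrict_multimap_def by blast
  qed
  have "{i \<in> I n. D n i \<inter> A \<noteq> {}} \<subseteq> J_plus I D f n"
  proof (induction n)
    case (Suc n)
    show ?case
    proof
      fix i assume i: "i \<in> {i \<in> I (Suc n). D (Suc n) i \<inter> A \<noteq> {}}"
      with nest obtain j where j: "j \<in> I n" "D (Suc n) i \<subseteq> D n j"
        unfolding nested_covers_def by blast
      with i plus[OF Suc.IH] have "j \<in> J_alg I D f n" by blast
      with i j show "i \<in> J_plus I D f (Suc n)" unfolding J_plus_Suc by blast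
    qed
  qed auto
  from plus[OF this] assms(3,4) show ?thesis by blast
qed

section \<open>Convergence to the attractor\<close>

text \<open>A limit of the schemes solves the reversed equation inside \<open>Q\<close>. By
  uniqueness it is the backward orbit of its initial value, which therefore belongs to the
  attractor.\<close>

lemma pseudo_orbits_cluster_in_attractor:
  fixes p :: "'n \<Rightarrow> nat \<Rightarrow> 'a::real_normed_vector"
  assumes sol: "solution_map g \<phi>"
    and Q: "compact Q" and g: "continuous_on Q g" and F: "F \<noteq> bot"
    and h: "(h \<longlongrightarrow> 0) F" and hpos: "eventually (\<lambda>n. 0 < h n) F"
    and E: "(E \<longlongrightarrow> 0) F"
    and pQ: "eventually (\<lambda>n. \<forall>k. p n k \<in> Q) F"
    and step: "eventually (\<lambda>n. \<forall>k. norm (p n (Suc k) - p n k + h n *\<^sub>R g (p n k)) \<le> h n * E n) F"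
  obtains G x where "G \<noteq> bot" "G \<le> F" "x \<in> attractor_in \<phi> Q" "((\<lambda>n. p n 0) \<longlongrightarrow> x) G"
proof -
  obtain G y where G: "G \<noteq> bot" "G \<le> F" and yQ: "\<And>t. y t \<in> Q"
    and lim: "((\<lambda>n. p n 0) \<longlongrightarrow> y 0) G"
    and y: "\<And>t. 0 \<le> t \<Longrightarrow> (y has_vector_derivative - g (y t)) (at t within {0..})"
    using perturbed_euler_limit[OF Q g F h hpos E pQ step] by metis
  have "y 0 \<in> attractor_in \<phi> Q"
    using backward_solution_unique[OF sol y] yQ by (simp add: mem_attractor_in_iff[OF sol])
  from that[OF G this lim] show thesis .
qed

theorem proposition14:
  fixes N :: "real ^ 'd \<Rightarrow> real"
    and g :: "real ^ 'd \<Rightarrow> real ^ 'd"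
    and \<phi> :: "real \<Rightarrow> real ^ 'd \<Rightarrow> real ^ 'd"
    and Q :: "(real ^ 'd) set"
    and h \<rho> :: "nat \<Rightarrow> real"
    and I :: "nat \<Rightarrow> 'i set"
    and D :: "nat \<Rightarrow> 'i \<Rightarrow> (real ^ 'd) set"
    and \<phi>d :: "nat \<Rightarrow> 'i \<Rightarrow> 'i set"
  assumes "vector_norm N"
    and "continuous_on UNIV g"
    and "solution_map g \<phi>"
    and "continuous_on UNIV (\<lambda>(t, x). \<phi> t x)"
    and "compact Q"
    and "\<And>n. 0 < h n" and "decseq h" and "h \<longlonglongrightarrow> 0"
    and "\<And>n. 0 < \<rho> n" and "decseq \<rho>" and "\<rho> \<longlonglongrightarrow> 0"
    and "\<And>n. rho_cover N (\<rho> n) Q (I n) (D n)"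
    and "nested_covers I D"
    and "\<And>n i. i \<in> I n \<Longrightarrow> \<phi>d n i \<subseteq> I n"
    and "\<And>n i. i \<in> I n \<Longrightarrow> \<phi> (- h n) ` D n i \<inter> Q \<subseteq> (\<Union>j\<in>\<phi>d n i. D n j)"
    and "(\<lambda>n. SUP i\<in>I n. SUP j\<in>\<phi>d n i. semidist N (D n j) (D n i)) \<longlonglongrightarrow> 0"
    and "(\<lambda>n. SUP i\<in>I n. SUP j\<in>\<phi>d n i. SUP x\<in>D n j. SUP z\<in>D n i.
            ennreal (N (inverse (h n) *\<^sub>R (x - z) + g z))) \<longlonglongrightarrow> 0"
  shows "(\<forall>n. attractor_in \<phi> Q \<subseteq> (\<Union>j\<in>J_alg I D \<phi>d n. D n j) \<and>
              (\<Union>j\<in>J_alg I D \<phi>d n. D n j) \<subseteq> discrete_attractor (I n) (D n) (\<phi>d n)) \<and>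
         (\<lambda>n. semidist N (\<Union>j\<in>J_alg I D \<phi>d n. D n j) (attractor_in \<phi> Q)) \<longlonglongrightarrow> 0"
proof -
  note sol = \<open>solution_map g \<phi>\<close>
  define A where "A = attractor_in \<phi> Q"
  define U where "U n = (\<Union>j\<in>J_alg I D \<phi>d n. D n j)" for n
  define S where "S n = (SUP i\<in>I n. SUP j\<in>\<phi>d n i. SUP x\<in>D n j. SUP z\<in>D n i.
            ennreal (N (inverse (h n) *\<^sub>R (x - z) + g z)))" for n
  have fin: "finite (I n)" and cov: "Q = (\<Union>i\<in>I n. D n i)"
    and ne: "i \<in> I n \<Longrightarrow> D n i \<noteq> {}" for n i
    using assms(12)[of n] by (auto simp: rho_cover_def)
  have AQ: "A \<subseteq> Q"
  proof
    fix x assume "x \<in> A"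
    then have "\<phi> (- 0) x \<in> Q" unfolding A_def mem_attractor_in_iff[OF sol] by blast
    then show "x \<in> Q" by (simp add: solution_map_zero[OF sol])
  qed
  have succ: "\<exists>j\<in>\<phi>d n i \<inter> I n. D n j \<inter> A \<noteq> {}" if "i \<in> I n" "D n i \<inter> A \<noteq> {}" for n i
  proof -
    from that obtain x where x: "x \<in> D n i" "x \<in> A" by blast
    \<comment> \<open>Backward invariance keeps the moved point in \<open>A\<close>, hence in
      \<open>Q\<close>, where the covering property of \<open>\<phi>d\<close> supplies a successor
      cell containing it.\<close>
    have "\<phi> (- h n) x \<in> A"
      using attractor_in_backward[OF sol] x(2) assms(6)[of n] by (simp add: A_def)
    with x AQ assms(14,15)[OF that(1)] show ?thesis by blast
  qed
  have lower: "A \<subseteq> U n" for n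
  proof
    fix x assume "x \<in> A"
    moreover from this AQ cov obtain i where "i \<in> I n" "x \<in> D n i" by blast
    ultimately show "x \<in> U n"
      using J_alg_memI[where f = \<phi>d and D = D and A = A, OF assms(13) succ] unfolding U_def by blast
  qed
  have upper: "U n \<subseteq> discrete_attractor (I n) (D n) (\<phi>d n)" for n
    using J_alg_subset_viable[of I D \<phi>d n] by (auto simp: U_def discrete_attractor_def)

  obtain c C where c: "0 < c" "\<And>x. norm x \<le> c * N x" and C: "\<And>x. N x \<le> C * norm x"
    using vector_norm_equivalent[OF assms(1)] by metis
  have N0: "0 \<le> N x" for x using assms(1) by (simp add: vector_norm_def)
  have chain: "\<exists>p. p 0 = x \<and> (\<forall>k. p k \<in> Q \<and>
      ennreal (N (inverse (h n) *\<^sub>R (p (Suc k) - p k) + g (p k))) \<le> S n)" if "x \<in> U n" for n x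
  proof -
    from that upper obtain i where i: "i \<in> viable_indices (I n) (\<phi>d n)" "x \<in> D n i"
      by (fastforce simp: discrete_attractor_def)
    obtain a where a: "a 0 = i" "\<And>k. a k \<in> I n" "\<And>k. a (Suc k) \<in> \<phi>d n (a k)"
      using viable_chain[OF fin assms(14) i(1)] by metis
    \<comment> \<open>The chain has to start at \<open>x\<close> itself. The later points may be any
      points of their cells, because \<open>S n\<close> bounds the defect for all choices.\<close>
    define p where "p k = (if k = 0 then x else SOME z. z \<in> D n (a k))" for k
    have p: "p k \<in> D n (a k)" for k
      using i(2) a(1) ne[OF a(2)[of k]] by (simp add: p_def some_in_eq)
    have "ennreal (N (inverse (h n) *\<^sub>R (p (Suc k) - p k) + g (p k))) \<le> S n" for k
      unfolding S_def using a(2)[of k] a(3)[of k] p[of "Suc k"] p[of k]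
      by (intro SUP_upper2[of "a k"] SUP_upper2[of "a (Suc k)"] SUP_upper2[of "p (Suc k)"]
          SUP_upper2[of "p k"] order_refl)
    moreover have "p k \<in> Q" for k using p[of k] a(2)[of k] cov[of n] by blast
    moreover have "p 0 = x" by (simp add: p_def)
    ultimately show ?thesis by blast
  qed

  have "(\<lambda>n. semidist N (U n) A) \<longlonglongrightarrow> 0"
  proof (rule order_tendstoI)
    fix e :: ennreal assume "0 < e"
    \<comment> \<open>A supremum of values at most \<open>b\<close> is only known to be at most
      \<open>b\<close>; the gap below \<open>e\<close> restores the strict inequality.\<close>
    then obtain b where b: "0 < b" "b < e" using dense by blast
    \<comment> \<open>If \<open>A\<close> is empty, every point of \<open>U n\<close> is bad, in
      accordance with the infimum over the empty set being infinite.\<close>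
    define bad where "bad n x \<longleftrightarrow> x \<in> U n \<and> (\<forall>y\<in>A. b < ennreal (N (x - y)))" for n x
    show "eventually (\<lambda>n. semidist N (U n) A < e) sequentially"
    proof (rule ccontr)
      assume not_ev: "\<not> eventually (\<lambda>n. semidist N (U n) A < e) sequentially"
      \<comment> \<open>Restricts the limit to the levels with a bad point, in place of a
        subsequence. It is nontrivial because otherwise the semidistance would eventually be at most
        \<open>b\<close>.\<close>
      define F where "F = inf sequentially (principal {n. \<exists>x. bad n x})"
      have F: "F \<noteq> bot"
      proof
        assume "F = bot"
        then have "eventually (\<lambda>n. \<not> (\<exists>x. bad n x)) sequentially"
          by (simp add: F_def trivial_limit_def eventually_inf_principal)
        then have "eventually (\<lambda>n. semidist N (U n) A < e) sequentially"
        proof eventually_elim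
          case (elim n)
          have "semidist N (U n) A \<le> b"
            unfolding semidist_def
          proof (rule SUP_least, rule ccontr)
            fix x assume "x \<in> U n" "\<not> (INF y\<in>A. ennreal (N (x - y))) \<le> b"
            then have "bad n x" by (auto simp: bad_def not_le dest: less_INF_D)
            with elim show False by blast
          qed
          with b(2) show ?case by simp
        qed
        with not_ev show False ..
      qed
      have Fseq: "F \<le> sequentially" by (simp add: F_def)
      have "\<exists>p. (\<exists>x. bad n x) \<longrightarrow> bad n (p 0) \<and> (\<forall>k. p k \<in> Q \<and>
          ennreal (N (inverse (h n) *\<^sub>R (p (Suc k) - p k) + g (p k))) \<le> S n)" for n
      proof (cases "\<exists>x. bad n x")
        case True
        then obtain x where "bad n x" ..
        moreover from this obtain p where "p 0 = x" "\<forall>k. p k \<in> Q \<and>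
          ennreal (N (inverse (h n) *\<^sub>R (p (Suc k) - p k) + g (p k))) \<le> S n"
          using chain[of x n] unfolding bad_def by blast
        ultimately show ?thesis by (intro exI[of _ p]) simp
      qed simp
      then have "\<forall>n. \<exists>p. (\<exists>x. bad n x) \<longrightarrow> bad n (p 0) \<and> (\<forall>k. p k \<in> Q \<and>
          ennreal (N (inverse (h n) *\<^sub>R (p (Suc k) - p k) + g (p k))) \<le> S n)" ..
      from choice[OF this] obtain p where p: "\<And>n. (\<exists>x. bad n x) \<Longrightarrow> bad n (p n 0) \<and> (\<forall>k. p n k \<in> Q \<and>
          ennreal (N (inverse (h n) *\<^sub>R (p n (Suc k) - p n k) + g (p n k))) \<le> S n)"
        by blast
      have evF: "eventually (\<lambda>n. bad n (p n 0) \<and> (\<forall>k. p n k \<in> Q \<and>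
          ennreal (N (inverse (h n) *\<^sub>R (p n (Suc k) - p n k) + g (p n k))) \<le> S n)) F"
        unfolding F_def eventually_inf_principal using p by (intro always_eventually) blast
      have SF: "(S \<longlongrightarrow> 0) F"
        using assms(17) filterlim_mono[OF _ order_refl Fseq] unfolding S_def by blast
      have hF: "(h \<longlongrightarrow> 0) F" using assms(8) filterlim_mono[OF _ order_refl Fseq] by blast
      \<comment> \<open>The factor \<open>c\<close> converts from \<open>N\<close> to the Euclidean
        norm. As \<open>enn2real\<close> sends infinity to 0, \<open>E n\<close> bounds the defect
        only where \<open>S n\<close> is finite, which \<open>Sfin\<close> provides
        eventually.\<close>
      define E where "E n = c * enn2real (S n)" for n
      have "((\<lambda>n. enn2real (S n)) \<longlongrightarrow> 0) F" using SF by (intro tendsto_enn2real) simp_all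
      then have EF: "(E \<longlongrightarrow> 0) F" unfolding E_def by (rule tendsto_mult_right_zero)
      have Sfin: "eventually (\<lambda>n. S n < top) F" using SF by (rule order_tendstoD) simp
      have step: "eventually (\<lambda>n. \<forall>k. norm (p n (Suc k) - p n k + h n *\<^sub>R g (p n k)) \<le> h n * E n) F"
        using evF Sfin
      proof eventually_elim
        case (elim n)
        show ?case
        proof
          fix k
          define v where "v = inverse (h n) *\<^sub>R (p n (Suc k) - p n k) + g (p n k)"
          have hn: "0 < h n" by (rule assms(6))
          have "N v \<le> enn2real (S n)"
            using elim enn2real_mono[of "ennreal (N v)" "S n"] N0 by (simp add: v_def)
          with c have "norm v \<le> E n"
            unfolding E_def by (meson less_imp_le mult_left_mono order_trans)
          moreover have "p n (Suc k) - p n k + h n *\<^sub>R g (p n k) = h n *\<^sub>R v"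
            using hn by (simp add: v_def scaleR_add_right)
          ultimately show "norm (p n (Suc k) - p n k + h n *\<^sub>R g (p n k)) \<le> h n * E n"
            using hn by simp
        qed
      qed
      obtain G x where G: "G \<noteq> bot" "G \<le> F" and x: "x \<in> A" and lim: "((\<lambda>n. p n 0) \<longlongrightarrow> x) G"
        unfolding A_def
      proof (rule pseudo_orbits_cluster_in_attractor[OF sol assms(5) _ F hF _ EF _ step])
        show "continuous_on Q g" using assms(2) continuous_on_subset by blast
        show "eventually (\<lambda>n. \<forall>k. p n k \<in> Q) F" using evF by eventually_elim blast
      qed (use assms(6) in auto)
      \<comment> \<open>The bad starting points converge along \<open>G\<close> to a point
        \<open>x\<close> of \<open>A\<close>, so their \<open>N\<close>-distance to \<open>x\<close>
        drops below \<open>b\<close>, against badness.\<close>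
      have "((\<lambda>n. C * norm (p n 0 - x)) \<longlongrightarrow> 0) G"
        using lim by (intro tendsto_mult_right_zero tendsto_norm_zero) (simp add: LIM_zero_iff)
      then have "((\<lambda>n. ennreal (C * norm (p n 0 - x))) \<longlongrightarrow> ennreal 0) G" by (rule tendsto_ennrealI)
      then have "eventually (\<lambda>n. ennreal (C * norm (p n 0 - x)) < b) G"
        using b(1) by (intro order_tendstoD(2)) simp_all
      moreover have "eventually (\<lambda>n. bad n (p n 0)) G"
        using evF G(2) by (auto simp: le_filter_def elim: eventually_mono)
      ultimately have "eventually (\<lambda>n. b < b) G"
      proof eventually_elim
        case (elim n)
        then have "b < ennreal (N (p n 0 - x))" using x by (simp add: bad_def)
        also have "\<dots> \<le> ennreal (C * norm (p n 0 - x))" by (rule ennreal_leI[OF C])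
        also have "\<dots> < b" by (rule elim)
        finally show ?case .
      qed
      with G(1) show False by (simp add: eventually_False)
    qed
  qed simp
  with lower upper show ?thesis by (simp add: A_def U_def)
qed

end
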